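(* Let $(X,d,\mu)$ be a space of homogeneous type with $\mu(X)=\infty$ and $\mu(\{x_0\})=0$ for every $x_0\in X$. Suppose $1<p<\infty$, $\lambda_1,\lambda_2\in A_p$, and $\nu:=\lambda_1^{1/p}\lambda_2^{-1/p}$. There exists a positive constant $C$, independent of $b$, such that the following holds. Suppose $b\in L^1_{\rm loc}(X)$ and that $C_b$ is bounded from $L^p_{\lambda_1}(X)$ to $L^p_{\lambda_2}(X)$. Then $b\in\mathrm{BMO}_\nu(X)$ and $$\|b\|_{\mathrm{BMO}_\nu(X)}\le C\,\big\|C_b:L^p_{\lambda_1}(X)\to L^p_{\lambda_2}(X)\big\| .$$
   Context: A space of homogeneous type $(X,d,\mu)$ consists of a set $X$ with a quasi-metric $d$ (that is, $d:X\times X\to[0,\infty)$ is symmetric, $d(x,y)=0$ iff $x=y$, and $d(x,y)\le A_0[d(x,z)+d(z,y)]$ for all $x,y,z$ with some constant $A_0\ge 1$) and a nonzero measure $\mu$ satisfying the doubling condition $\mu(B(x,2r))\le C_\mu\,\mu(B(x,r))<\infty$ for all $x\in X$, $r>0$, where $B(x,r)=\{y\in X: d(x,y)<r\}$ are the quasi-metric balls. "Ball" always means such a ball. Muckenhoupt weights: for $1<p<\infty$, a nonnegative locally integrable function $w$ on $X$ is in $A_p$ if $$[w]_{A_p}:=\sup_B\Big(\frac1{\mu(B)}\int_B w\,d\mu\Big)\Big(\frac1{\mu(B)}\int_B w^{-1/(p-1)}\,d\mu\Big)^{p-1}<\infty,$$ the supremum being over all balls $B\subset X$. For a weight $w$ write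 $w(B)=\int_B w\,d\mu$, and let $L^p_w(X)$ be the space of functions with $\|f\|_{L^p_w(X)}=\big(\int_X|f|^p w\,d\mu\big)^{1/p}<\infty$. Weighted BMO: for a weight $w$ in the Muckenhoupt class $A_\infty$ (which contains $\nu$), $b\in L^1_{\rm loc}(X)$ belongs to $\mathrm{BMO}_w(X)$ if $$\|b\|_{\mathrm{BMO}_w(X)}:=\sup_B\frac1{w(B)}\int_B|b(x)-b_B|\,d\mu(x)<\infty,\qquad b_B=\frac1{\mu(B)}\int_B b\,d\mu,$$ the supremum being over all balls $B\subset X$. The maximal commutator with symbol $b$ is $$C_b(f)(x):=\sup_{B\ni x}\frac1{\mu(B)}\int_B|b(x)-b(y)|\,|f(y)|\,d\mu(y),$$ the supremum being over all balls $B\subset X$ containing $x$. For a (not necessarily linear) operator $S$, $\|S:L^p_{\lambda_1}(X)\to L^p_{\lambda_2}(X)\|$ is the least constant $K$ with $\|Sf\|_{L^p_{\lambda_2}(X)}\le K\|f\|_{L^p_{\lambda_1}(X)}$ for all $f\in L^p_{\lambda_1}(X)$; $S$ is bounded if this is finite. *)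

theory Defs
  imports "HOL-Analysis.Analysis"
begin

definition quasi_metric_on :: "'a set \<Rightarrow> ('a \<Rightarrow> 'a \<Rightarrow> real) \<Rightarrow> bool" where
  "quasi_metric_on X d \<longleftrightarrow>
     (\<forall>x\<in>X. \<forall>y\<in>X. 0 \<le> d x y) \<and>
     (\<forall>x\<in>X. \<forall>y\<in>X. d x y = d y x) \<and>
     (\<forall>x\<in>X. \<forall>y\<in>X. d x y = 0 \<longleftrightarrow> x = y) \<and>
     (\<exists>A0\<ge>1. \<forall>x\<in>X. \<forall>y\<in>X. \<forall>z\<in>X. d x y \<le> A0 * (d x z + d z y))"

definition qball :: "'a set \<Rightarrow> ('a \<Rightarrow> 'a \<Rightarrow> real) \<Rightarrow> 'a \<Rightarrow> real \<Rightarrow> 'a set" where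
  "qball X d x r = {y \<in> X. d x y < r}"

definition qballs :: "'a set \<Rightarrow> ('a \<Rightarrow> 'a \<Rightarrow> real) \<Rightarrow> 'a set set" where
  "qballs X d = {qball X d x r | x r. x \<in> X \<and> 0 < r}"

text \<open>The set \<open>X\<close> is \<open>space M\<close>. Balls of a quasi-metric need not be open, so their measurability,
  implicit in the doubling condition, is required explicitly; nothing else is assumed about the
  sigma-algebra.\<close>

definition homogeneous_type_space :: "'a measure \<Rightarrow> ('a \<Rightarrow> 'a \<Rightarrow> real) \<Rightarrow> bool" where
  "homogeneous_type_space M d \<longleftrightarrow>
     quasi_metric_on (space M) d \<and>
     emeasure M (space M) \<noteq> 0 \<and>
     qballs (space M) d \<subseteq> sets M \<and>
     (\<exists>C::real. \<forall>x\<in>space M. \<forall>r>0.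
        emeasure M (qball (space M) d x (2 * r)) \<le> ennreal C * emeasure M (qball (space M) d x r) \<and>
        emeasure M (qball (space M) d x r) < \<infinity>)"

text \<open>Local integrability means integrability on every ball.\<close>

definition locally_integrable ::
  "'a measure \<Rightarrow> ('a \<Rightarrow> 'a \<Rightarrow> real) \<Rightarrow> ('a \<Rightarrow> 'b::{banach, second_countable_topology}) \<Rightarrow> bool" where
  "locally_integrable M d f \<longleftrightarrow> (\<forall>B\<in>qballs (space M) d. set_integrable M B f)"

text \<open>Real powers on \<open>[0,\<infinity>]\<close>. Unlike \<open>powr\<close> on the reals, \<open>0\<close> to a negative power is \<open>\<infinity>\<close>;
  this matters for \<open>w\<^sup>-\<^sup>1\<^sup>/\<^sup>(\<^sup>p\<^sup>-\<^sup>1\<^sup>)\<close> in the Muckenhoupt condition.\<close>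

definition epowr :: "ennreal \<Rightarrow> real \<Rightarrow> ennreal" (infixr "epowr" 80) where
  "x epowr a =
     (if a = 0 then 1
      else if x = 0 then (if 0 < a then 0 else \<infinity>)
      else if x = \<infinity> then (if 0 < a then \<infinity> else 0)
      else ennreal (enn2real x powr a))"

definition nn_average :: "'a measure \<Rightarrow> 'a set \<Rightarrow> ('a \<Rightarrow> ennreal) \<Rightarrow> ennreal" where
  "nn_average M B g = (\<integral>\<^sup>+x\<in>B. g x \<partial>M) / emeasure M B"

definition Ap_const ::
  "'a measure \<Rightarrow> ('a \<Rightarrow> 'a \<Rightarrow> real) \<Rightarrow> real \<Rightarrow> ('a \<Rightarrow> real) \<Rightarrow> ennreal" where
  "Ap_const M d p w =
     (SUP B\<in>qballs (space M) d.
        nn_average M B (\<lambda>x. ennreal (w x)) *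
        nn_average M B (\<lambda>x. ennreal (w x) epowr (- 1 / (p - 1))) epowr (p - 1))"

text \<open>The function \<open>w = 0\<close> a.e. is not a weight. It has to be excluded explicitly since
  \<open>0 * \<infinity> = 0\<close> in \<^typ>\<open>ennreal\<close>. All other nonnegative functions with finite constant are
  a.e. positive: otherwise some large ball gives the product \<open>c * \<infinity>\<close> with \<open>c > 0\<close>.\<close>

definition Ap_weights ::
  "'a measure \<Rightarrow> ('a \<Rightarrow> 'a \<Rightarrow> real) \<Rightarrow> real \<Rightarrow> ('a \<Rightarrow> real) set" where
  "Ap_weights M d p =
     {w. (\<forall>x\<in>space M. 0 \<le> w x) \<and> locally_integrable M d w \<and> \<not> (AE x in M. w x = 0) \<and>
         Ap_const M d p w < \<infinity>}"

text \<open>The norm takes \<open>[0,\<infinity>]\<close>-valued functions; it is applied to \<open>|f|\<close> and to the values of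
  \<open>[0,\<infinity>]\<close>-valued operators. For non-measurable integrands \<^const>\<open>nn_integral\<close> is the lower
  integral, so no measurability of the values of an operator is presupposed.\<close>

definition Lp_norm :: "'a measure \<Rightarrow> real \<Rightarrow> ('a \<Rightarrow> real) \<Rightarrow> ('a \<Rightarrow> ennreal) \<Rightarrow> ennreal" where
  "Lp_norm M p w g = (\<integral>\<^sup>+x. g x epowr p * ennreal (w x) \<partial>M) epowr (1 / p)"

definition Lp_space :: "'a measure \<Rightarrow> real \<Rightarrow> ('a \<Rightarrow> real) \<Rightarrow> ('a \<Rightarrow> complex) set" where
  "Lp_space M p w = {f \<in> borel_measurable M. Lp_norm M p w (\<lambda>x. ennreal (cmod (f x))) < \<infinity>}"

text \<open>The least admissible constant, and \<open>\<infinity>\<close> if there is no finite one.\<close>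

definition Lp_operator_norm ::
  "'a measure \<Rightarrow> real \<Rightarrow> ('a \<Rightarrow> real) \<Rightarrow> ('a \<Rightarrow> real) \<Rightarrow>
   (('a \<Rightarrow> complex) \<Rightarrow> 'a \<Rightarrow> ennreal) \<Rightarrow> ennreal" where
  "Lp_operator_norm M p w1 w2 S =
     Inf {K. \<forall>f\<in>Lp_space M p w1.
            Lp_norm M p w2 (S f) \<le> K * Lp_norm M p w1 (\<lambda>x. ennreal (cmod (f x)))}"

definition maximal_commutator ::
  "'a measure \<Rightarrow> ('a \<Rightarrow> 'a \<Rightarrow> real) \<Rightarrow> ('a \<Rightarrow> complex) \<Rightarrow> ('a \<Rightarrow> complex) \<Rightarrow> 'a \<Rightarrow> ennreal" where
  "maximal_commutator M d b f x =
     (SUP B\<in>{B \<in> qballs (space M) d. x \<in> B}.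
        nn_average M B (\<lambda>y. ennreal (cmod (b x - b y) * cmod (f y))))"

definition average :: "'a measure \<Rightarrow> 'a set \<Rightarrow> ('a \<Rightarrow> complex) \<Rightarrow> complex" where
  "average M B b = (LINT x:B|M. b x) / of_real (measure M B)"

definition BMO_norm ::
  "'a measure \<Rightarrow> ('a \<Rightarrow> 'a \<Rightarrow> real) \<Rightarrow> ('a \<Rightarrow> real) \<Rightarrow> ('a \<Rightarrow> complex) \<Rightarrow> ennreal" where
  "BMO_norm M d w b =
     (SUP B\<in>qballs (space M) d.
        (\<integral>\<^sup>+x\<in>B. ennreal (cmod (b x - average M B b)) \<partial>M) / (\<integral>\<^sup>+x\<in>B. ennreal (w x) \<partial>M))"

definition BMO ::
  "'a measure \<Rightarrow> ('a \<Rightarrow> 'a \<Rightarrow> real) \<Rightarrow> ('a \<Rightarrow> real) \<Rightarrow> ('a \<Rightarrow> complex) set" where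
  "BMO M d w = {b. locally_integrable M d b \<and> BMO_norm M d w b < \<infinity>}"

end

theory Submission
  imports Defs
begin

text \<open>
  The theorem is proved by testing the maximal commutator on indicator functions of balls. Write
  \<open>\<langle>g\<rangle>\<close> for the average of \<open>g\<close> over a fixed ball \<open>B\<close>, and \<open>\<sigma>\<^sub>i = \<lambda>\<^sub>i\<^sup>-\<^sup>1\<^sup>/\<^sup>(\<^sup>p\<^sup>-\<^sup>1\<^sup>)\<close> for the weight dual
  to \<open>\<lambda>\<^sub>i\<close>.

  For \<open>x \<in> B\<close> the ball \<open>B\<close> itself is admissible in the supremum defining \<open>C\<^sub>b(1\<^sub>B)(x)\<close>, so that
  \<open>\<bar>b(x) - b\<^sub>B\<bar> \<le> \<langle>\<bar>b(x) - b\<bar>\<rangle> \<le> C\<^sub>b(1\<^sub>B)(x)\<close>. Hoelder's inequality applied to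
  \<open>\<bar>b - b\<^sub>B\<bar> = (\<bar>b - b\<^sub>B\<bar> \<lambda>\<^sub>2\<^sup>1\<^sup>/\<^sup>p) \<lambda>\<^sub>2\<^sup>-\<^sup>1\<^sup>/\<^sup>p\<close> then gives, for every constant \<open>K\<close> admissible in the
  operator norm,
  \<open>\<langle>\<bar>b - b\<^sub>B\<bar>\<rangle> \<le> K \<langle>\<lambda>\<^sub>1\<rangle>\<^sup>1\<^sup>/\<^sup>p \<langle>\<sigma>\<^sub>2\<rangle>\<^sup>1\<^sup>-\<^sup>1\<^sup>/\<^sup>p\<close>; this is \<open>oscillation_le_commutator_bound\<close>.

  It remains to compare the right-hand side with \<open>\<langle>\<nu>\<rangle>\<close>, which is \<open>quotient_weight_average_bound\<close>.
  By Cauchy-Schwarz \<open>1 \<le> \<langle>\<nu>\<rangle> \<langle>\<nu>\<^sup>-\<^sup>1\<rangle>\<close>, and by Hoelder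
  \<open>\<langle>\<nu>\<^sup>-\<^sup>1\<rangle> = \<langle>\<lambda>\<^sub>2\<^sup>1\<^sup>/\<^sup>p \<lambda>\<^sub>1\<^sup>-\<^sup>1\<^sup>/\<^sup>p\<rangle> \<le> \<langle>\<lambda>\<^sub>2\<rangle>\<^sup>1\<^sup>/\<^sup>p \<langle>\<sigma>\<^sub>1\<rangle>\<^sup>1\<^sup>-\<^sup>1\<^sup>/\<^sup>p\<close>. Multiplying
  \<open>1 \<le> \<langle>\<nu>\<rangle> \<langle>\<lambda>\<^sub>2\<rangle>\<^sup>1\<^sup>/\<^sup>p \<langle>\<sigma>\<^sub>1\<rangle>\<^sup>1\<^sup>-\<^sup>1\<^sup>/\<^sup>p\<close> by \<open>\<langle>\<lambda>\<^sub>1\<rangle>\<^sup>1\<^sup>/\<^sup>p \<langle>\<sigma>\<^sub>2\<rangle>\<^sup>1\<^sup>-\<^sup>1\<^sup>/\<^sup>p\<close>, the factors other than \<open>\<langle>\<nu>\<rangle>\<close> regroup into the \<open>p\<close>-th roots of the \<open>A\<^sub>p\<close> quantities of \<open>\<lambda>\<^sub>1\<close> and \<open>\<lambda>\<^sub>2\<close> on \<open>B\<close>: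
  \<open>\<langle>\<lambda>\<^sub>1\<rangle>\<^sup>1\<^sup>/\<^sup>p \<langle>\<sigma>\<^sub>2\<rangle>\<^sup>1\<^sup>-\<^sup>1\<^sup>/\<^sup>p \<le> ([\<lambda>\<^sub>1] [\<lambda>\<^sub>2])\<^sup>1\<^sup>/\<^sup>p \<langle>\<nu>\<rangle>\<close>, where \<open>[\<lambda>\<^sub>i]\<close> is the \<open>A\<^sub>p\<close> constant.

  All of this takes place in \<open>[0,\<infinity>]\<close>. It rests on two facts: balls have positive
  finite measure, which is where doubling enters (\<open>emeasure_qballs_pos\<close>), and Muckenhoupt weights are positive almost everywhere
  (\<open>Ap_weights_AE_pos\<close>), without which \<open>\<lambda>\<^sub>i \<sigma>\<^sub>i\<^sup>p\<^sup>-\<^sup>1 = 1\<close> fails because \<open>0 \<cdot> \<infinity> = 0\<close>.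
\<close>

section \<open>Real powers of extended nonnegative reals\<close>

lemma epowr_ennreal: "0 < r \<Longrightarrow> ennreal r epowr a = ennreal (r powr a)"
  by (auto simp: epowr_def)

lemma epowr_0_left [simp]: "0 < a \<Longrightarrow> 0 epowr a = 0"
  by (simp add: epowr_def)

lemma epowr_top_left [simp]: "0 < a \<Longrightarrow> top epowr a = top"
  by (simp add: epowr_def)

lemma epowr_1_left [simp]: "1 epowr a = 1"
  by (simp add: epowr_def)

lemma epowr_1_right [simp]: "x epowr 1 = x"
  by (cases x) (auto simp: epowr_def)

lemma ennreal_0_top_pos_cases [case_names zero top pos]:
  fixes x :: ennreal
  obtains "x = 0" | "x = top" | r where "0 < r" "x = ennreal r"
  by (cases x) (auto simp: le_less)

text \<open>The exponent is positive because \<open>0 \<cdot> \<infinity> = 0\<close> in \<^typ>\<open>ennreal\<close>: positive powers fix \<open>0\<close> and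
  \<open>\<infinity>\<close>, while for negative ones \<open>x = 0\<close>, \<open>y = \<infinity>\<close> would give \<open>\<infinity>\<close> on the left and \<open>0\<close> on the
  right.\<close>

lemma epowr_mult:
  assumes "0 < a"
  shows "(x * y) epowr a = x epowr a * y epowr a"
proof (cases x rule: ennreal_0_top_pos_cases)
  case top
  with assms show ?thesis
    by (cases y rule: ennreal_0_top_pos_cases)
       (auto simp: epowr_ennreal ennreal_top_mult)
next
  case (pos r)
  with assms show ?thesis
    by (cases y rule: ennreal_0_top_pos_cases)
       (auto simp: epowr_ennreal ennreal_mult_top powr_mult simp flip: ennreal_mult)
qed (use assms in auto)

lemma epowr_epowr:
  assumes "0 < a" "0 < b"
  shows "(x epowr a) epowr b = x epowr (a * b)"
  using assms by (cases x rule: ennreal_0_top_pos_cases) (auto simp: epowr_ennreal powr_powr)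

lemma epowr_mono:
  assumes "0 < a" "x \<le> y"
  shows "x epowr a \<le> y epowr a"
  using assms
  by (cases x rule: ennreal_0_top_pos_cases; cases y rule: ennreal_0_top_pos_cases)
     (auto simp: epowr_ennreal top_unique intro!: powr_mono2 ennreal_leI)

lemma epowr_eq_top_iff: "0 < a \<Longrightarrow> x epowr a = top \<longleftrightarrow> x = top"
  by (cases x rule: ennreal_0_top_pos_cases) (auto simp: epowr_ennreal)

lemma borel_measurable_epowr [measurable (raw)]:
  assumes [measurable]: "f \<in> borel_measurable M"
  shows "(\<lambda>x. f x epowr a) \<in> borel_measurable M"
  unfolding epowr_def by measurable

section \<open>Hoelder's inequality\<close>

text \<open>This is the weighted inequality between geometric and arithmetic means. It persists at the
  endpoints: the left-hand side vanishes if an argument is \<open>0\<close>, and otherwise the right-hand side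
  is \<open>\<infinity>\<close> as soon as an argument is.\<close>

lemma epowr_Youngs_inequality:
  assumes "0 < \<theta>" "\<theta> < 1"
  shows "u epowr \<theta> * v epowr (1 - \<theta>) \<le> ennreal \<theta> * u + ennreal (1 - \<theta>) * v"
proof (cases u rule: ennreal_0_top_pos_cases)
  case top
  with assms show ?thesis by (simp add: ennreal_mult_top)
next
  case (pos r)
  note u = this
  show ?thesis
  proof (cases v rule: ennreal_0_top_pos_cases)
    case top
    with assms show ?thesis by (simp add: ennreal_mult_top)
  next
    case (pos s)
    have "r powr \<theta> * s powr (1 - \<theta>) \<le> \<theta> * r + (1 - \<theta>) * s"
      using Youngs_inequality_0[of \<theta> "1 - \<theta>" r s] u pos assms by simp
    with u pos assms show ?thesis
      by (simp add: epowr_ennreal flip: ennreal_mult ennreal_plus)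
  qed (use assms in auto)
qed (use assms in auto)

text \<open>Hoelder's inequality in the homogeneous form with exponents \<open>\<theta>\<close> and \<open>1 - \<theta>\<close> on the
  integrands; the usual form has \<open>\<theta> = 1/p\<close>, \<open>u = f\<^sup>p\<close>, \<open>v = g\<^sup>q\<close>. After both integrals are
  normalised to \<open>1\<close> it is the integral of the pointwise Young inequality.\<close>

lemma nn_integral_Holder:
  assumes \<theta>: "0 < \<theta>" "\<theta> < 1"
    and [measurable]: "u \<in> borel_measurable M" "v \<in> borel_measurable M"
  shows "(\<integral>\<^sup>+x. u x epowr \<theta> * v x epowr (1 - \<theta>) \<partial>M)
         \<le> (\<integral>\<^sup>+x. u x \<partial>M) epowr \<theta> * (\<integral>\<^sup>+x. v x \<partial>M) epowr (1 - \<theta>)"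
    (is "?I \<le> ?U epowr \<theta> * ?V epowr (1 - \<theta>)")
proof -
  consider "?U = 0" | "?V = 0" | "?U \<noteq> 0" "?V \<noteq> 0" "?U = top \<or> ?V = top"
    | "?U \<noteq> 0" "?V \<noteq> 0" "?U \<noteq> top" "?V \<noteq> top" by blast
  then show ?thesis
  proof cases
    case 1
    then have "AE x in M. u x = 0" by (simp add: nn_integral_0_iff_AE)
    then have "AE x in M. u x epowr \<theta> * v x epowr (1 - \<theta>) = 0"
      by eventually_elim (use \<theta> in simp)
    then have "?I = 0" by (subst nn_integral_0_iff_AE) auto
    then show ?thesis by simp
  next
    case 2
    then have "AE x in M. v x = 0" by (simp add: nn_integral_0_iff_AE)
    then have "AE x in M. u x epowr \<theta> * v x epowr (1 - \<theta>) = 0"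
      by eventually_elim (use \<theta> in simp)
    then have "?I = 0" by (subst nn_integral_0_iff_AE) auto
    then show ?thesis by simp
  next
    case 3
    have "x epowr a \<noteq> 0" if "x \<noteq> 0" "0 < a" for x a
      using that by (cases x rule: ennreal_0_top_pos_cases) (auto simp: epowr_ennreal)
    with 3 \<theta> show ?thesis by (auto simp: ennreal_mult_top ennreal_top_mult)
  next
    case 4
    let ?c = "?U epowr \<theta> * ?V epowr (1 - \<theta>)"
    have "?I = (\<integral>\<^sup>+x. ((u x / ?U) epowr \<theta> * (v x / ?V) epowr (1 - \<theta>)) * ?c \<partial>M)"
    proof (intro nn_integral_cong)
      fix x
      have "u x = u x / ?U * ?U" "v x = v x / ?V * ?V"
        using 4 by (simp_all add: ennreal_divide_times ennreal_divide_self less_top)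
      then have "u x epowr \<theta> = (u x / ?U) epowr \<theta> * ?U epowr \<theta>"
        "v x epowr (1 - \<theta>) = (v x / ?V) epowr (1 - \<theta>) * ?V epowr (1 - \<theta>)"
        using \<theta> by (metis epowr_mult diff_gt_0_iff_gt)+
      then show "u x epowr \<theta> * v x epowr (1 - \<theta>)
          = ((u x / ?U) epowr \<theta> * (v x / ?V) epowr (1 - \<theta>)) * ?c"
        by (simp add: mult_ac)
    qed
    also have "\<dots> \<le> (\<integral>\<^sup>+x. (ennreal \<theta> * (u x / ?U) + ennreal (1 - \<theta>) * (v x / ?V)) * ?c \<partial>M)"
      by (intro nn_integral_mono mult_right_mono epowr_Youngs_inequality \<theta>) simp
    also have "\<dots> = (ennreal \<theta> * (?U / ?U) + ennreal (1 - \<theta>) * (?V / ?V)) * ?c"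
      by (simp add: nn_integral_multc nn_integral_add nn_integral_cmult nn_integral_divide)
    also have "ennreal \<theta> * (?U / ?U) + ennreal (1 - \<theta>) * (?V / ?V) = 1"
      using 4 \<theta> by (simp add: ennreal_divide_self less_top flip: ennreal_plus)
    finally show ?thesis by simp
  qed
qed

section \<open>Balls and locally integrable functions\<close>

lemma qball_doubling_exhaustion:
  assumes X: "homogeneous_type_space M d" and x: "x \<in> space M" and r: "0 < r"
  shows "incseq (\<lambda>n. qball (space M) d x (2 ^ n * r))"
    and "(\<Union>n. qball (space M) d x (2 ^ n * r)) = space M"
proof -
  have "2 ^ m * r \<le> 2 ^ n * r" if "m \<le> n" for m n :: nat
    using that r by (intro mult_right_mono power_increasing) auto
  then show "incseq (\<lambda>n. qball (space M) d x (2 ^ n * r))"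
    unfolding incseq_def qball_def by (auto intro: less_le_trans)
  have "\<exists>n. d x y < 2 ^ n * r" for y
    using real_arch_pow[of 2 "d x y / r"] r by (auto simp: field_simps)
  then show "(\<Union>n. qball (space M) d x (2 ^ n * r)) = space M"
    by (auto simp: qball_def)
qed

lemma qballI: "x \<in> X \<Longrightarrow> 0 < r \<Longrightarrow> qball X d x r \<in> qballs X d"
  by (auto simp: qballs_def)

lemma sets_qballs: "homogeneous_type_space M d \<Longrightarrow> B \<in> qballs (space M) d \<Longrightarrow> B \<in> sets M"
  by (auto simp: homogeneous_type_space_def)

lemma emeasure_qballs_finite:
  "homogeneous_type_space M d \<Longrightarrow> B \<in> qballs (space M) d \<Longrightarrow> emeasure M B < \<infinity>"
  unfolding homogeneous_type_space_def qballs_def by blast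

text \<open>By doubling, a null ball would make all its dilates null, and these exhaust the space, whose
  measure is nonzero.\<close>

lemma emeasure_qballs_pos:
  assumes X: "homogeneous_type_space M d" and B: "B \<in> qballs (space M) d"
  shows "0 < emeasure M B"
proof (rule ccontr)
  obtain x r where xr: "x \<in> space M" "0 < r" "B = qball (space M) d x r"
    using B by (auto simp: qballs_def)
  let ?B = "\<lambda>n::nat. qball (space M) d x (2 ^ n * r)"
  obtain C :: real where C: "\<And>s. 0 < s \<Longrightarrow> emeasure M (qball (space M) d x (2 * s))
      \<le> ennreal C * emeasure M (qball (space M) d x s)"
    using X xr by (auto simp: homogeneous_type_space_def)
  assume "\<not> 0 < emeasure M B"
  then have "emeasure M (?B n) = 0" for n
  proof (induction n)
    case (Suc n)
    then show ?case using C[of "2 ^ n * r"] xr by (simp add: mult.assoc)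
  qed (simp add: xr)
  moreover have "?B n \<in> sets M" for n
    using xr by (intro sets_qballs[OF X] qballI) auto
  ultimately have "emeasure M (\<Union>n. ?B n) = 0"
    by (intro emeasure_UN_eq_0) auto
  then show False
    using X qball_doubling_exhaustion(2)[OF X xr(1,2)] by (simp add: homogeneous_type_space_def)
qed

text \<open>Integrability on balls only gives measurability of \<open>1\<^sub>B f\<close>; since countably many increasing
  balls exhaust the space, \<open>f\<close> is a pointwise limit of such functions.\<close>

lemma locally_integrable_borel_measurable:
  fixes f :: "'a \<Rightarrow> 'b::{banach, second_countable_topology}"
  assumes X: "homogeneous_type_space M d" and f: "locally_integrable M d f"
  shows "f \<in> borel_measurable M"
proof (cases "space M = {}")
  case True
  then show ?thesis using X by (simp add: homogeneous_type_space_def)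
next
  case False
  then obtain x where x: "x \<in> space M" by blast
  let ?B = "\<lambda>n::nat. qball (space M) d x (2 ^ n * 1)"
  note exh = qball_doubling_exhaustion[OF X x zero_less_one]
  show ?thesis
  proof (rule borel_measurable_LIMSEQ_metric)
    show "(\<lambda>y. indicator (?B n) y *\<^sub>R f y) \<in> borel_measurable M" for n
    proof -
      have "?B n \<in> qballs (space M) d" using x by (intro qballI) auto
      with f have "integrable M (\<lambda>y. indicator (?B n) y *\<^sub>R f y)"
        unfolding locally_integrable_def set_integrable_def by blast
      then show ?thesis by (rule borel_measurable_integrable)
    qed
    fix y assume "y \<in> space M"
    then obtain m where "y \<in> ?B m" using exh(2) by blast
    then have "\<And>n. m \<le> n \<Longrightarrow> y \<in> ?B n" using exh(1) by (meson incseqD subsetD)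
    then show "(\<lambda>n. indicator (?B n) y *\<^sub>R f y) \<longlonglongrightarrow> f y"
      by (intro tendsto_eventually eventually_sequentiallyI[of m]) simp
  qed
qed

text \<open>Averages are integrals, so they inherit inequalities for integrals such as Hoelder's.\<close>

lemma nn_average_eq_uniform_measure:
  assumes "B \<in> sets M" "g \<in> borel_measurable M"
  shows "nn_average M B g = (\<integral>\<^sup>+x. g x \<partial>uniform_measure M B)"
  unfolding nn_average_def by (rule nn_integral_uniform_measure[symmetric]) fact+

lemma nn_average_Holder:
  assumes "0 < \<theta>" "\<theta> < 1" "B \<in> sets M"
    and [measurable]: "u \<in> borel_measurable M" "v \<in> borel_measurable M"
  shows "nn_average M B (\<lambda>x. u x epowr \<theta> * v x epowr (1 - \<theta>))
         \<le> nn_average M B u epowr \<theta> * nn_average M B v epowr (1 - \<theta>)"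
  using nn_integral_Holder[of \<theta> u "uniform_measure M B" v] assms
  by (simp add: nn_average_eq_uniform_measure)

lemma nn_average_cong_AE:
  assumes "AE x in M. x \<in> B \<longrightarrow> f x = g x"
  shows "nn_average M B f = nn_average M B g"
  unfolding nn_average_def using assms
  by (intro arg_cong2[where f = "(/)"] nn_integral_cong_AE) (auto split: split_indicator)

lemma nn_average_const:
  assumes "B \<in> sets M" "0 < emeasure M B" "emeasure M B < \<infinity>"
  shows "nn_average M B (\<lambda>_. c) = c"
  using assms by (simp add: nn_average_def nn_integral_cmult_indicator ennreal_mult_divide_eq)

section \<open>Muckenhoupt weights\<close>

text \<open>If \<open>w\<close> vanished on a subset of positive measure of some ball, then \<open>w\<^sup>-\<^sup>1\<^sup>/\<^sup>(\<^sup>p\<^sup>-\<^sup>1\<^sup>)\<close> would have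
  infinite average over every larger ball. On a large enough one the average of \<open>w\<close> is nonzero,
  because \<open>w\<close> is not a.e. zero, and the \<open>A\<^sub>p\<close> product would be infinite there.\<close>

lemma Ap_weights_AE_pos:
  assumes X: "homogeneous_type_space M d" and p: "1 < p" and w: "w \<in> Ap_weights M d p"
  shows "AE x in M. 0 < w x"
proof -
  have lint: "locally_integrable M d w" and nz: "\<not> (AE x in M. w x = 0)"
    and fin: "Ap_const M d p w < \<infinity>" and nn: "\<And>x. x \<in> space M \<Longrightarrow> 0 \<le> w x"
    using w by (auto simp: Ap_weights_def)
  have [measurable]: "w \<in> borel_measurable M"
    using X lint by (rule locally_integrable_borel_measurable)
  obtain x where x: "x \<in> space M"
    using X by (metis homogeneous_type_space_def ex_in_conv emeasure_empty)
  define B where "B = (\<lambda>n::nat. qball (space M) d x (2 ^ n * 1))"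
  have inc: "incseq B" and un: "(\<Union>n. B n) = space M"
    unfolding B_def by (rule qball_doubling_exhaustion[OF X x zero_less_one])+
  have ball: "B n \<in> qballs (space M) d" for n
    unfolding B_def using x by (intro qballI) auto
  then have [measurable]: "B n \<in> sets M" for n by (rule sets_qballs[OF X])
  define W where "W = (\<lambda>n. \<integral>\<^sup>+y\<in>B n. ennreal (w y) \<partial>M)"
  have "\<exists>m. W m \<noteq> 0"
  proof (rule ccontr)
    assume "\<nexists>m. W m \<noteq> 0"
    then have "AE y in M. ennreal (w y) * indicator (B n) y = 0" for n
      by (auto simp: W_def nn_integral_0_iff_AE)
    then have "AE y in M. \<forall>n. ennreal (w y) * indicator (B n) y = 0"
      unfolding AE_all_countable by blast
    with AE_space have "AE y in M. w y = 0"
    proof eventually_elim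
      case (elim y)
      then obtain n where "y \<in> B n" using un by blast
      with elim(2) have "ennreal (w y) = 0" by (metis indicator_simps(1) mult.right_neutral)
      with nn[OF elim(1)] show ?case by simp
    qed
    with nz show False ..
  qed
  then obtain m where m: "W m \<noteq> 0" ..
  have "AE y in M. n \<ge> m \<longrightarrow> y \<in> B n \<longrightarrow> 0 < w y" for n
  proof (cases "n \<ge> m")
    case True
    let ?\<sigma> = "\<lambda>y. ennreal (w y) epowr (- 1 / (p - 1))"
    have "W m \<le> W n" unfolding W_def
      using inc True by (intro nn_integral_mono) (auto simp: incseq_def split: split_indicator)
    with m have "W n \<noteq> 0" by auto
    then have "W n / emeasure M (B n) \<noteq> 0"
      using emeasure_qballs_finite[OF X ball[of n]] by (simp add: ennreal_divide_eq_0_iff)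
    moreover have "nn_average M (B n) (\<lambda>x. ennreal (w x)) * nn_average M (B n) ?\<sigma> epowr (p - 1)
        \<le> Ap_const M d p w"
      unfolding Ap_const_def by (rule SUP_upper[OF ball])
    ultimately have "nn_average M (B n) ?\<sigma> epowr (p - 1) \<noteq> top"
      using fin unfolding W_def nn_average_def[of _ _ "\<lambda>x. ennreal (w x)"]
      by (auto simp: ennreal_mult_top top_unique)
    with p have "nn_average M (B n) ?\<sigma> \<noteq> top" by (simp add: epowr_eq_top_iff)
    then have "(\<integral>\<^sup>+y. ?\<sigma> y * indicator (B n) y \<partial>M) \<noteq> top"
      using emeasure_qballs_finite[OF X ball[of n]]
      by (auto simp: nn_average_def ennreal_top_divide split: if_splits)
    then have "AE y in M. ?\<sigma> y * indicator (B n) y \<noteq> \<infinity>"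
      by (intro nn_integral_PInf_AE) auto
    with AE_space show ?thesis
    proof eventually_elim
      case (elim y)
      show ?case
      proof (intro impI)
        assume "y \<in> B n"
        with elim(2) have "?\<sigma> y \<noteq> \<infinity>" by simp
        moreover have "?\<sigma> y = \<infinity>" if "w y = 0" using p that by (simp add: epowr_def)
        ultimately show "0 < w y" using nn[OF elim(1)] by (metis less_le)
      qed
    qed
  qed simp
  then have "AE y in M. \<forall>n. n \<ge> m \<longrightarrow> y \<in> B n \<longrightarrow> 0 < w y"
    by (simp add: AE_all_countable)
  with AE_space show ?thesis
  proof eventually_elim
    case (elim y)
    then obtain n where "y \<in> B n" using un by blast
    then have "y \<in> B (max m n)" using inc by (meson incseqD max.cobounded2 subsetD)
    with elim(2) show ?case by (meson max.cobounded1)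
  qed
qed

lemma Ap_const_root_bound:
  assumes p: "1 < p" and B: "B \<in> qballs (space M) d"
  shows "nn_average M B (\<lambda>x. ennreal (w x)) epowr (1 / p)
         * nn_average M B (\<lambda>x. ennreal (w x) epowr (- 1 / (p - 1))) epowr (1 - 1 / p)
         \<le> Ap_const M d p w epowr (1 / p)"
    (is "?a epowr _ * ?s epowr _ \<le> _")
proof -
  have "?a * ?s epowr (p - 1) \<le> Ap_const M d p w"
    unfolding Ap_const_def by (rule SUP_upper[OF B])
  then have "(?a * ?s epowr (p - 1)) epowr (1 / p) \<le> Ap_const M d p w epowr (1 / p)"
    using p by (intro epowr_mono) auto
  moreover have "(p - 1) * (1 / p) = 1 - 1 / p" using p by (simp add: field_simps)
  ultimately show ?thesis using p by (simp add: epowr_mult epowr_epowr)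
qed

lemma Ap_weights_measurable:
  assumes "homogeneous_type_space M d" "w \<in> Ap_weights M d p"
  shows "w \<in> borel_measurable M"
  using assms locally_integrable_borel_measurable by (auto simp: Ap_weights_def)

text \<open>The average of \<open>\<nu>\<close> is bounded from below through the average of \<open>\<nu>\<^sup>-\<^sup>1\<close>, which Hoelder's
  inequality controls by the factors complementary to those on the left: together they form one
  full \<open>A\<^sub>p\<close> product for each of the two weights.\<close>

lemma quotient_weight_average_bound:
  assumes X: "homogeneous_type_space M d" and p: "1 < p"
    and l1: "w1 \<in> Ap_weights M d p" and l2: "w2 \<in> Ap_weights M d p"
    and B: "B \<in> qballs (space M) d"
  shows "nn_average M B (\<lambda>x. ennreal (w1 x)) epowr (1 / p)
         * nn_average M B (\<lambda>x. ennreal (w2 x) epowr (- 1 / (p - 1))) epowr (1 - 1 / p)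
         \<le> (Ap_const M d p w1 * Ap_const M d p w2) epowr (1 / p)
            * nn_average M B (\<lambda>x. ennreal (w1 x powr (1 / p) * w2 x powr (- 1 / p)))"
proof -
  define \<nu> where "\<nu> = (\<lambda>x. ennreal (w1 x powr (1 / p) * w2 x powr (- 1 / p)))"
  define s1 where "s1 = (\<lambda>x. ennreal (w1 x) epowr (- 1 / (p - 1)))"
  define s2 where "s2 = (\<lambda>x. ennreal (w2 x) epowr (- 1 / (p - 1)))"
  \<comment> \<open>almost everywhere \<open>h\<close> is the reciprocal of \<open>\<nu>\<close>, already factored for Hoelder\<close>
  define h where "h = (\<lambda>x. ennreal (w2 x) epowr (1 / p) * s1 x epowr (1 - 1 / p))"
  have [measurable]: "w1 \<in> borel_measurable M" "w2 \<in> borel_measurable M"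
    using X l1 l2 by (auto intro: Ap_weights_measurable)
  have [measurable]: "\<nu> \<in> borel_measurable M" "s1 \<in> borel_measurable M" "h \<in> borel_measurable M"
    unfolding \<nu>_def s1_def h_def by measurable
  have BM: "B \<in> sets M" by (rule sets_qballs[OF X B])
  let ?av = "nn_average M B"
  let ?l1 = "\<lambda>x. ennreal (w1 x)" and ?l2 = "\<lambda>x. ennreal (w2 x)"
  have p': "0 < 1 / p" "1 / p < 1" using p by auto
  have "AE x in M. 0 < w1 x" "AE x in M. 0 < w2 x"
    using Ap_weights_AE_pos[OF X p] l1 l2 by auto
  then have "AE x in M. x \<in> B \<longrightarrow> 1 = \<nu> x epowr (1 / 2) * h x epowr (1 - 1 / 2)"
  proof eventually_elim
    case (elim x)
    have "- 1 / (p - 1) * (1 - 1 / p) = - (1 / p)" using p by (simp add: field_simps)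
    then have "s1 x epowr (1 - 1 / p) = ennreal (w1 x powr - (1 / p))"
      unfolding s1_def using elim by (simp add: epowr_ennreal powr_powr)
    then have "\<nu> x * h x = ennreal ((w1 x powr (1 / p) * w1 x powr - (1 / p))
        * (w2 x powr (1 / p) * w2 x powr - (1 / p)))"
      unfolding \<nu>_def h_def using elim by (simp add: epowr_ennreal mult_ac flip: ennreal_mult)
    also have "\<dots> = 1" using elim by (simp flip: powr_add)
    finally have "\<nu> x * h x = 1" .
    then show ?case by (simp flip: epowr_mult)
  qed
  then have "1 = ?av (\<lambda>x. \<nu> x epowr (1 / 2) * h x epowr (1 - 1 / 2))"
    using nn_average_cong_AE[where M = M and B = B and f = "\<lambda>_. 1"] nn_average_const[OF BM, of 1]
      emeasure_qballs_pos[OF X B] emeasure_qballs_finite[OF X B] by auto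
  also have "\<dots> \<le> ?av \<nu> epowr (1 / 2) * ?av h epowr (1 - 1 / 2)"
    by (rule nn_average_Holder) (auto intro: BM)
  finally have "1 \<le> (?av \<nu> * ?av h) epowr (1 / 2)" by (simp add: epowr_mult)
  then have "1 \<le> ((?av \<nu> * ?av h) epowr (1 / 2)) epowr 2"
    using epowr_mono[of 2 1] by simp
  then have "1 \<le> ?av \<nu> * ?av h" by (simp add: epowr_epowr)
  also have "?av h \<le> ?av ?l2 epowr (1 / p) * ?av s1 epowr (1 - 1 / p)"
    unfolding h_def using p' BM by (intro nn_average_Holder) auto
  finally have "1 \<le> ?av \<nu> * (?av ?l2 epowr (1 / p) * ?av s1 epowr (1 - 1 / p))"
    by (simp add: mult_left_mono)
  \<comment> \<open>the added factors complete one \<open>A\<^sub>p\<close> product for each weight\<close>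
  then have "?av ?l1 epowr (1 / p) * ?av s2 epowr (1 - 1 / p)
     \<le> ?av ?l1 epowr (1 / p) * ?av s2 epowr (1 - 1 / p) *
        (?av \<nu> * (?av ?l2 epowr (1 / p) * ?av s1 epowr (1 - 1 / p)))"
    using mult_left_mono[of 1 _ "?av ?l1 epowr (1 / p) * ?av s2 epowr (1 - 1 / p)"] by simp
  also have "\<dots> = (?av ?l1 epowr (1 / p) * ?av s1 epowr (1 - 1 / p))
      * (?av ?l2 epowr (1 / p) * ?av s2 epowr (1 - 1 / p)) * ?av \<nu>"
    by (simp add: mult_ac)
  also have "\<dots> \<le> Ap_const M d p w1 epowr (1 / p) * Ap_const M d p w2 epowr (1 / p) * ?av \<nu>"
    unfolding s1_def s2_def by (intro mult_mono Ap_const_root_bound[OF p B]) auto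
  finally show ?thesis using p' by (simp add: \<nu>_def s2_def epowr_mult)
qed

section \<open>Testing the maximal commutator on balls\<close>

text \<open>The value \<open>b x - b\<^sub>B\<close> is the average over \<open>B\<close> of \<open>b x - b\<close>, hence bounded by the average
  of its modulus. The latter is the term of the ball \<open>B\<close> in the supremum that defines the
  commutator.\<close>

lemma maximal_commutator_indicator_lower_bound:
  fixes b :: "'a \<Rightarrow> complex"
  assumes X: "homogeneous_type_space M d" and b: "locally_integrable M d b"
    and B: "B \<in> qballs (space M) d" and x: "x \<in> B"
  shows "ennreal (cmod (b x - average M B b)) \<le> maximal_commutator M d b (indicator B) x"
proof -
  have [measurable]: "B \<in> sets M" by (rule sets_qballs[OF X B])
  have fin: "emeasure M B < \<infinity>" by (rule emeasure_qballs_finite[OF X B])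
  have m: "0 < measure M B"
    using emeasure_qballs_pos[OF X B] fin by (simp add: measure_def enn2real_positive_iff)
  have bB: "set_integrable M B b" using b B by (simp add: locally_integrable_def)
  have cB: "set_integrable M B (\<lambda>_. b x)"
    using fin by (simp add: set_integrable_def integrable_real_indicator)
  define F where "F = (\<lambda>y. indicator B y *\<^sub>R (b x - b y))"
  have F: "integrable M F"
    using set_integral_diff(1)[OF cB bB] by (simp add: F_def set_integrable_def)
  have "(LINT y|M. F y) = (LINT y:B|M. b x) - (LINT y:B|M. b y)"
    using set_integral_diff(2)[OF cB bB] by (simp add: F_def set_lebesgue_integral_def)
  also have "(LINT y:B|M. b x) = of_real (measure M B) * b x"
    using fin by (simp add: set_lebesgue_integral_def scaleR_conv_of_real)
  finally have "(LINT y|M. F y) = of_real (measure M B) * (b x - average M B b)"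
    using m by (simp add: average_def right_diff_distrib)
  then have "cmod (b x - average M B b) = norm (LINT y|M. F y) / measure M B"
    using m by (simp add: norm_mult)
  also have "\<dots> \<le> (LINT y|M. norm (F y)) / measure M B"
    using m by (intro divide_right_mono integral_norm_bound) auto
  finally have "ennreal (cmod (b x - average M B b))
      \<le> ennreal ((LINT y|M. norm (F y)) / measure M B)"
    by (rule ennreal_leI)
  also have "\<dots> = ennreal (LINT y|M. norm (F y)) / ennreal (measure M B)"
    using m by (simp add: divide_ennreal)
  also have "ennreal (LINT y|M. norm (F y)) = (\<integral>\<^sup>+y. ennreal (norm (F y)) \<partial>M)"
    using F by (intro nn_integral_eq_integral[symmetric]) auto
  also have "\<dots> = (\<integral>\<^sup>+y\<in>B. ennreal (cmod (b x - b y) * cmod (indicator B y)) \<partial>M)"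
    by (intro nn_integral_cong) (auto simp: F_def split: split_indicator)
  also have "ennreal (measure M B) = emeasure M B"
    using fin by (simp add: emeasure_eq_ennreal_measure)
  also have "(\<integral>\<^sup>+y\<in>B. ennreal (cmod (b x - b y) * cmod (indicator B y)) \<partial>M) / emeasure M B
      \<le> maximal_commutator M d b (indicator B) x"
    unfolding maximal_commutator_def nn_average_def
    using B x by (intro SUP_upper2[of B]) auto
  finally show ?thesis .
qed

text \<open>The commutator bound is tested on the indicator function of \<open>B\<close>, whose weighted norm is
  \<open>(\<integral>\<^sub>B w1)\<^sup>1\<^sup>/\<^sup>p\<close>. The values of the maximal commutator may fail to be measurable; its measurable
  minorant \<open>\<bar>b - b\<^sub>B\<bar>\<close> on \<open>B\<close> is substituted before Hoelder's inequality removes the weight.\<close>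

lemma oscillation_le_commutator_bound:
  fixes b :: "'a \<Rightarrow> complex"
  assumes X: "homogeneous_type_space M d" and p: "1 < p"
    and l1: "w1 \<in> Ap_weights M d p" and l2: "w2 \<in> Ap_weights M d p"
    and b: "locally_integrable M d b" and B: "B \<in> qballs (space M) d"
    and K: "\<And>f. f \<in> Lp_space M p w1 \<Longrightarrow> Lp_norm M p w2 (maximal_commutator M d b f)
              \<le> K * Lp_norm M p w1 (\<lambda>x. ennreal (cmod (f x)))"
  shows "nn_average M B (\<lambda>x. ennreal (cmod (b x - average M B b)))
         \<le> K * (nn_average M B (\<lambda>x. ennreal (w1 x)) epowr (1 / p)
              * nn_average M B (\<lambda>x. ennreal (w2 x) epowr (- 1 / (p - 1))) epowr (1 - 1 / p))"
proof -
  let ?av = "nn_average M B"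
  define m where "m = emeasure M B"
  define g where "g = (\<lambda>x. ennreal (cmod (b x - average M B b)))"
  define s where "s = (\<lambda>x. ennreal (w2 x) epowr (- 1 / (p - 1)))"
  have p': "0 < 1 / p" "1 / p < 1" using p by auto
  have [measurable]: "B \<in> sets M" by (rule sets_qballs[OF X B])
  have [measurable]: "w1 \<in> borel_measurable M" "w2 \<in> borel_measurable M"
    using X l1 l2 by (auto intro: Ap_weights_measurable)
  have [measurable]: "b \<in> borel_measurable M"
    by (rule locally_integrable_borel_measurable[OF X b])
  have [measurable]: "g \<in> borel_measurable M" "s \<in> borel_measurable M"
    unfolding g_def s_def by measurable
  let ?f = "indicator B :: 'a \<Rightarrow> complex"
  have norm_f: "Lp_norm M p w1 (\<lambda>x. ennreal (cmod (?f x)))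
      = (\<integral>\<^sup>+x\<in>B. ennreal (w1 x) \<partial>M) epowr (1 / p)"
    unfolding Lp_norm_def using p
    by (intro arg_cong2[where f = "(epowr)"] nn_integral_cong) (auto split: split_indicator)
  have "integrable M (\<lambda>x. indicator B x *\<^sub>R w1 x)"
    using l1 B by (auto simp: Ap_weights_def locally_integrable_def set_integrable_def)
  then have "(\<integral>\<^sup>+x. ennreal (norm (indicator B x *\<^sub>R w1 x)) \<partial>M) < \<infinity>"
    by (simp add: integrable_iff_bounded)
  moreover have "(\<integral>\<^sup>+x\<in>B. ennreal (w1 x) \<partial>M) \<le> (\<integral>\<^sup>+x. ennreal (norm (indicator B x *\<^sub>R w1 x)) \<partial>M)"
    by (intro nn_integral_mono) (auto split: split_indicator intro!: ennreal_leI)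
  ultimately have "(\<integral>\<^sup>+x\<in>B. ennreal (w1 x) \<partial>M) \<noteq> top" by (auto simp: top_unique)
  then have "?f \<in> Lp_space M p w1"
    unfolding Lp_space_def mem_Collect_eq norm_f using p'(1) by (simp add: epowr_eq_top_iff flip: less_top)
  note K' = K[OF this, unfolded norm_f]

  have "(\<integral>\<^sup>+x\<in>B. (g x epowr p * ennreal (w2 x)) \<partial>M)
      \<le> (\<integral>\<^sup>+x. maximal_commutator M d b ?f x epowr p * ennreal (w2 x) \<partial>M)"
    using maximal_commutator_indicator_lower_bound[OF X b B] p
    by (intro nn_integral_mono) (auto simp: g_def split: split_indicator intro!: mult_right_mono epowr_mono)
  then have "(\<integral>\<^sup>+x\<in>B. (g x epowr p * ennreal (w2 x)) \<partial>M) epowr (1 / p)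
      \<le> Lp_norm M p w2 (maximal_commutator M d b ?f)"
    unfolding Lp_norm_def by (intro epowr_mono p')
  also note K'
  \<comment> \<open>both integrals become averages after multiplication by the same power of the measure of \<open>B\<close>\<close>
  finally have "(\<integral>\<^sup>+x\<in>B. (g x epowr p * ennreal (w2 x)) \<partial>M) epowr (1 / p) * inverse m epowr (1 / p)
     \<le> K * (\<integral>\<^sup>+x\<in>B. ennreal (w1 x) \<partial>M) epowr (1 / p) * inverse m epowr (1 / p)"
    by (rule mult_right_mono) simp
  then have test: "?av (\<lambda>x. g x epowr p * ennreal (w2 x)) epowr (1 / p)
     \<le> K * ?av (\<lambda>x. ennreal (w1 x)) epowr (1 / p)"
    unfolding nn_average_def divide_ennreal_def m_def using p' by (simp add: epowr_mult mult.assoc)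

  have "AE x in M. x \<in> B \<longrightarrow> g x
      = (g x epowr p * ennreal (w2 x)) epowr (1 / p) * s x epowr (1 - 1 / p)"
    using Ap_weights_AE_pos[OF X p l2]
  proof eventually_elim
    case (elim x)
    have "- 1 / (p - 1) * (1 - 1 / p) = - (1 / p)" using p by (simp add: field_simps)
    then have "ennreal (w2 x) epowr (1 / p) * s x epowr (1 - 1 / p) = 1"
      unfolding s_def using elim
      by (simp add: epowr_ennreal powr_powr flip: ennreal_mult powr_add)
    moreover have "(g x epowr p) epowr (1 / p) = g x" using p by (simp add: epowr_epowr)
    ultimately show ?case using p' by (simp add: epowr_mult mult.assoc)
  qed
  then have "?av g = ?av (\<lambda>x. (g x epowr p * ennreal (w2 x)) epowr (1 / p) * s x epowr (1 - 1 / p))"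
    by (rule nn_average_cong_AE)
  also have "\<dots> \<le> ?av (\<lambda>x. g x epowr p * ennreal (w2 x)) epowr (1 / p) * ?av s epowr (1 - 1 / p)"
    by (rule nn_average_Holder[OF p']) auto
  also have "\<dots> \<le> K * ?av (\<lambda>x. ennreal (w1 x)) epowr (1 / p) * ?av s epowr (1 - 1 / p)"
    by (rule mult_right_mono[OF test]) simp
  finally show ?thesis by (simp add: g_def s_def mult.assoc)
qed

theorem theorem1p3:
  fixes M :: "'a measure" and d :: "'a \<Rightarrow> 'a \<Rightarrow> real"
    and p :: real and lambda1 lambda2 \<nu> :: "'a \<Rightarrow> real"
  assumes "homogeneous_type_space M d"
    and "emeasure M (space M) = \<infinity>"
    and "\<forall>x0\<in>space M. emeasure M {x0} = 0"
    and "1 < p"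
    and "lambda1 \<in> Ap_weights M d p"
    and "lambda2 \<in> Ap_weights M d p"
    and "\<nu> = (\<lambda>x. lambda1 x powr (1 / p) * lambda2 x powr (- 1 / p))"
  shows "\<exists>C::real. 0 < C \<and>
    (\<forall>b::'a \<Rightarrow> complex.
       locally_integrable M d b \<longrightarrow>
       Lp_operator_norm M p lambda1 lambda2 (maximal_commutator M d b) < \<infinity> \<longrightarrow>
       b \<in> BMO M d \<nu> \<and>
       BMO_norm M d \<nu> b
         \<le> ennreal C * Lp_operator_norm M p lambda1 lambda2 (maximal_commutator M d b))"
proof -
  note X = assms(1)
  define A where "A = (Ap_const M d p lambda1 * Ap_const M d p lambda2) epowr (1 / p)"
  have "Ap_const M d p lambda1 * Ap_const M d p lambda2 < top"
    using assms(5,6) by (simp add: Ap_weights_def ennreal_mult_less_top)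
  then have "A \<noteq> top" using assms(4) by (auto simp: A_def epowr_eq_top_iff)
  \<comment> \<open>adding \<open>1\<close> makes the constant positive without showing that \<open>A\<close> is nonzero\<close>
  define C where "C = 1 + enn2real A"
  have C: "0 < C" "A \<le> ennreal C"
  proof -
    show "0 < C" by (simp add: C_def add_pos_nonneg)
    have "A = ennreal (enn2real A)" using \<open>A \<noteq> top\<close> by (simp add: less_top)
    also have "\<dots> \<le> ennreal C" by (intro ennreal_leI) (simp add: C_def)
    finally show "A \<le> ennreal C" .
  qed
  have bound: "BMO_norm M d \<nu> b
      \<le> ennreal C * Lp_operator_norm M p lambda1 lambda2 (maximal_commutator M d b)"
    if b: "locally_integrable M d b" for b :: "'a \<Rightarrow> complex"
  proof -
    let ?\<K> = "{K. \<forall>f\<in>Lp_space M p lambda1. Lp_norm M p lambda2 (maximal_commutator M d b f)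
                \<le> K * Lp_norm M p lambda1 (\<lambda>x. ennreal (cmod (f x)))}"
    have "BMO_norm M d \<nu> b \<le> ennreal C * K" if K: "K \<in> ?\<K>" for K
      unfolding BMO_norm_def
    proof (rule SUP_least)
      fix B assume B: "B \<in> qballs (space M) d"
      let ?m = "emeasure M B"
      let ?D = "\<integral>\<^sup>+x\<in>B. ennreal (cmod (b x - average M B b)) \<partial>M"
      let ?N = "\<integral>\<^sup>+x\<in>B. ennreal (\<nu> x) \<partial>M"
      have m: "?m \<noteq> 0" "?m \<noteq> top"
        using emeasure_qballs_pos[OF X B] emeasure_qballs_finite[OF X B] by auto
      have "?D / ?m \<le> K * (nn_average M B (\<lambda>x. ennreal (lambda1 x)) epowr (1 / p)
          * nn_average M B (\<lambda>x. ennreal (lambda2 x) epowr (- 1 / (p - 1))) epowr (1 - 1 / p))"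
        using oscillation_le_commutator_bound[OF X assms(4-6) b B, of K] K
        by (simp add: nn_average_def)
      also have "\<dots> \<le> K * (A * (?N / ?m))"
        using quotient_weight_average_bound[OF X assms(4-6) B]
        by (intro mult_left_mono) (simp_all add: A_def assms(7) nn_average_def)
      also have "\<dots> \<le> K * (ennreal C * (?N / ?m))"
        by (intro mult_left_mono mult_right_mono C) auto
      finally have "?D / ?m * ?m \<le> K * (ennreal C * (?N / ?m)) * ?m"
        by (rule mult_right_mono) simp
      moreover have "a / ?m * ?m = a" for a
        using m by (simp add: ennreal_divide_times ennreal_divide_self less_top)
      ultimately have le: "?D \<le> ennreal C * K * ?N"
        by (simp only: mult.assoc mult.left_commute[of K])
      show "?D / ?N \<le> ennreal C * K"
      proof (cases "?N = 0")
        case True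
        with le show ?thesis by simp
      next
        case False
        with le show ?thesis by (intro divide_le_posI_ennreal) (auto simp: mult.commute zero_less_iff_neq_zero)
      qed
    qed
    \<comment> \<open>dividing by \<open>C\<close> turns the bound into a lower bound of the set of admissible constants\<close>
    then have "BMO_norm M d \<nu> b / ennreal C \<le> Inf ?\<K>"
      using C by (intro Inf_greatest divide_le_posI_ennreal) auto
    then have "ennreal C * (BMO_norm M d \<nu> b / ennreal C) \<le> ennreal C * Inf ?\<K>"
      by (rule mult_left_mono) simp
    then show ?thesis
      using C by (simp add: Lp_operator_norm_def ennreal_times_divide mult.commute[of "ennreal C"]
          ennreal_mult_divide_eq)
  qed
  show ?thesis
  proof (intro exI[of _ C] conjI allI impI C(1) bound)
    fix b :: "'a \<Rightarrow> complex"
    assume b: "locally_integrable M d b"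
      and fin: "Lp_operator_norm M p lambda1 lambda2 (maximal_commutator M d b) < \<infinity>"
    then have "ennreal C * Lp_operator_norm M p lambda1 lambda2 (maximal_commutator M d b) < \<infinity>"
      by (simp add: ennreal_mult_less_top)
    with bound[OF b] b show "b \<in> BMO M d \<nu>"
      by (auto simp: BMO_def intro: le_less_trans)
  qed
qed

end
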